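(* Let $s_{-1}=0$, $s_0=1$, and let $s_1,s_2,\dots\in\{\pm1\}$ be defined recursively by $s_{2i}=(-1)^i s_i$ and $s_{2i+1}=s_i$. For $n\ge1$ set $d_n=\frac{s_n-s_{n-2}}{s_{n-1}}$. Then $$\sum_{k=0}^\infty x^{2^k}=\frac{x\,\vert}{\vert\,1-d_1x}+\frac{x^2\,\vert}{\vert\, 1-d_2x}+\frac{x^2\,\vert}{\vert\, 1-d_3x}+\cdots=\frac{x\,\vert}{\vert\,1-x}+\frac{x^2\,\vert}{\vert\, 1+2x}+\frac{x^2\,\vert}{\vert\, 1}+\frac{x^2\,\vert}{\vert\, 1}+\frac{x^2\,\vert}{\vert\, 1-2x}+\cdots$$ (the first partial numerator is $x$, and all subsequent partial numerators are $x^2$; the $n$-th partial denominator is $1-d_nx$).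
   Context: The notation $\frac{a_1\vert}{\vert b_1}+\frac{a_2\vert}{\vert b_2}+\frac{a_3\vert}{\vert b_3}+\cdots$ denotes the formal continued fraction $a_1/(b_1+a_2/(b_2+a_3/(b_3+\cdots)))$ with $a_i,b_i\in\mathbb{C}[x]$. Its $k$-th partial convergent is the rational function $\frac{P_k}{Q_k}=\frac{a_1\vert}{\vert b_1}+\cdots+\frac{a_k\vert}{\vert b_k}$. The continued fraction converges if, for each power of $x$, the corresponding coefficient in the formal Laurent series expansion (at $x=0$) of the partial convergents is ultimately constant as $k\to\infty$; its value is then the formal Laurent series formed by these ultimate coefficients. Equality of a power series with a continued fraction means that the continued fraction converges in this sense to that power series. *)

theory Defs
  imports "HOL-Computational_Algebra.Computational_Algebra"
begin

section \<open>Laurent expansion of rational functions\<close>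

text \<open>The embedding of the rational functions \<open>K(x)\<close> into the formal Laurent series \<open>K((x))\<close>,
  that is, expansion at \<open>x = 0\<close>.\<close>

definition laurent_of_fract :: "'a::field poly fract \<Rightarrow> 'a fls" where
  "laurent_of_fract r = (THE f. \<exists>p q. q \<noteq> 0 \<and> r = Fract p q \<and>
     f = fps_to_fls (fps_of_poly p) / fps_to_fls (fps_of_poly q))"

lemma laurent_of_fract_Fract:
  assumes "q \<noteq> 0"
  shows "laurent_of_fract (Fract p q) = fps_to_fls (fps_of_poly p) / fps_to_fls (fps_of_poly q)"
  unfolding laurent_of_fract_def
proof (rule the_equality)
  fix f
  assume "\<exists>p' q'. q' \<noteq> 0 \<and> Fract p q = Fract p' q' \<and>
            f = fps_to_fls (fps_of_poly p') / fps_to_fls (fps_of_poly q')"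
  then obtain p' q' where q': "q' \<noteq> 0" and eq: "Fract p q = Fract p' q'"
    and f: "f = fps_to_fls (fps_of_poly p') / fps_to_fls (fps_of_poly q')"
    by blast
  from eq have "p * q' = p' * q"
    using assms q' by (simp add: eq_fract)
  then show "f = fps_to_fls (fps_of_poly p) / fps_to_fls (fps_of_poly q)"
    using assms q'
    by (simp add: f frac_eq_eq flip: fls_times_fps_to_fls fps_of_poly_mult)
qed (use assms in blast)


section \<open>Formal continued fractions\<close>

text \<open>A continued fraction is given by its partial numerators \<open>a 1, a 2, \<dots>\<close> and its partial
  denominators \<open>b 1, b 2, \<dots>\<close>; the values \<open>a 0\<close> and \<open>b 0\<close> are ignored.
  \<open>cf_segment a b j m\<close> is the rational function
  \<open>a j / (b j + a (j+1) / (b (j+1) + \<dots> + a (j+m-1) / b (j+m-1)))\<close>.\<close>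

primrec cf_segment ::
  "(nat \<Rightarrow> 'a::field poly) \<Rightarrow> (nat \<Rightarrow> 'a poly) \<Rightarrow> nat \<Rightarrow> nat \<Rightarrow> 'a poly fract" where
  "cf_segment a b j 0 = 0"
| "cf_segment a b j (Suc m) = to_fract (a j) / (to_fract (b j) + cf_segment a b (Suc j) m)"

definition cf_convergent ::
  "(nat \<Rightarrow> 'a::field poly) \<Rightarrow> (nat \<Rightarrow> 'a poly) \<Rightarrow> nat \<Rightarrow> 'a poly fract" where
  "cf_convergent a b k = cf_segment a b 1 k"

text \<open>Division by zero is total in HOL. \<open>cf_defined\<close> says that no denominator occurring in any
  of the partial convergents vanishes, so that \<open>cf_convergent\<close> never relies on \<open>x / 0 = 0\<close>.\<close>

definition cf_defined :: "(nat \<Rightarrow> 'a::field poly) \<Rightarrow> (nat \<Rightarrow> 'a poly) \<Rightarrow> bool" where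
  "cf_defined a b \<longleftrightarrow> (\<forall>j\<ge>1. \<forall>m. to_fract (b j) + cf_segment a b (Suc j) m \<noteq> 0)"

definition cf_converges_to ::
  "(nat \<Rightarrow> 'a::field poly) \<Rightarrow> (nat \<Rightarrow> 'a poly) \<Rightarrow> 'a fls \<Rightarrow> bool" where
  "cf_converges_to a b F \<longleftrightarrow> cf_defined a b \<and>
     (\<forall>n::int. \<forall>\<^sub>F k in sequentially.
        fls_nth (laurent_of_fract (cf_convergent a b k)) n = fls_nth F n)"


section \<open>The sign sequence\<close>

text \<open>\<open>s_seq\<close> is indexed by the integers, since \<open>s_seq (- 1) = 0\<close> is needed; the value \<open>0\<close> at indices
  below \<open>- 1\<close> is a dummy.\<close>

function s_seq :: "int \<Rightarrow> int" where
  "s_seq n = (if n < 0 then 0 else if n = 0 then 1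
          else if even n then (- 1) ^ nat (n div 2) * s_seq (n div 2)
          else s_seq (n div 2))"
  by pat_completeness auto
termination by (relation "measure nat") auto

declare s_seq.simps [simp del]

lemma s_seq_minus_1: "s_seq (- 1) = 0"
  and s_seq_0: "s_seq 0 = 1"
  by (simp_all add: s_seq.simps)

lemma s_seq_even: "i \<ge> 0 \<Longrightarrow> s_seq (2 * i) = (- 1) ^ nat i * s_seq i"
  by (cases "i = 0") (simp_all add: s_seq.simps [of "2 * i"])

lemma s_seq_odd: "i \<ge> 0 \<Longrightarrow> s_seq (2 * i + 1) = s_seq i"
proof -
  assume "i \<ge> 0"
  then have "\<not> 2 * i + 1 < 0" "2 * i + 1 \<noteq> 0" "odd (2 * i + 1)" "(2 * i + 1) div 2 = i"
    by auto
  then show ?thesis by (subst s_seq.simps) simp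
qed

lemma s_seq_values: "n \<ge> 0 \<Longrightarrow> s_seq n \<in> {1, - 1}"
proof (induction "nat n" arbitrary: n rule: less_induct)
  case less
  show ?case
  proof (cases "n = 0")
    case True
    then show ?thesis by (simp add: s_seq_0)
  next
    case False
    with less.prems have "s_seq (n div 2) \<in> {1, - 1}"
      by (intro less.hyps) auto
    moreover have "(- 1) ^ m \<in> {1, - 1 :: int}" for m :: nat
      by (cases "even m") auto
    ultimately show ?thesis
      using False less.prems by (subst s_seq.simps) (force split: if_splits)
  qed
qed

definition d_seq :: "nat \<Rightarrow> complex" where
  "d_seq n = of_int (s_seq (int n) - s_seq (int n - 2)) / of_int (s_seq (int n - 1))"

abbreviation X :: "complex poly" where "X \<equiv> [:0, 1:]"

end

theory Submission
  imports Defs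
begin

text \<open>
  Write \<open>F\<close> for the lacunary series and \<open>P\<^sub>n / Q\<^sub>n\<close> for the convergents. The proof studies the
  remainders \<open>r\<^sub>n = Q\<^sub>n F - P\<^sub>n\<close>, which satisfy the three-term recurrence of the continued fraction,
  and shows that they tend to \<open>0\<close> in the \<open>X\<close>-adic topology. Since \<open>Q\<^sub>n\<close> has constant coefficient
  \<open>1\<close>, this is equivalent to convergence of the continued fraction to \<open>F\<close>.

  The sign sequence enters through the products \<open>\<sigma>\<^sub>n = s\<^sub>n s\<^sub>n\<^sub>-\<^sub>1\<close>. As \<open>s\<^sub>n = \<plusminus>1\<close>, one has
  \<open>d\<^sub>n = \<sigma>\<^sub>n - \<sigma>\<^sub>n\<^sub>-\<^sub>1\<close>, and the rules for \<open>s\<close> become \<open>\<sigma>\<^sub>2\<^sub>n\<^sub>+\<^sub>1 = (-1)\<^sup>n\<close> and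
  \<open>\<sigma>\<^sub>2\<^sub>n = (-1)\<^sup>n \<sigma>\<^sub>n\<close>. These are exactly what is needed for every solution \<open>y\<close> of the recurrence to
  have the following self-similarity (\<open>recurrence_doubling\<close>): the contracted sequence
  \<open>y\<^sub>2\<^sub>n\<^sub>+\<^sub>1 + (-1)\<^sup>n X y\<^sub>2\<^sub>n\<close> solves the same recurrence with \<open>X\<^sup>2\<close> in place of \<open>X\<close>. For the
  remainders the functional equation \<open>F(X) = X + F(X\<^sup>2)\<close> makes the initial values agree as well,
  whence \<open>r\<^sub>2\<^sub>n\<^sub>+\<^sub>1 + (-1)\<^sup>n X r\<^sub>2\<^sub>n = r\<^sub>n(X\<^sup>2)\<close> (\<open>remainder_doubling\<close>).

  Substituting \<open>X\<^sup>2\<close> doubles the order of vanishing at \<open>0\<close>, so this identity transports information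
  from \<open>r\<^sub>n\<close> to \<open>r\<^sub>2\<^sub>n\<close> and \<open>r\<^sub>2\<^sub>n\<^sub>+\<^sub>1\<close>, and a strong induction shows that \<open>X\<^sup>n\<^sup>+\<^sup>1\<close> divides \<open>r\<^sub>n\<close>
  (\<open>X_power_dvd_remainder\<close>). The true order is \<open>2n + 1\<close>, but the weaker bound is the one for
  which the induction closes.
\<close>

section \<open>Convergence of continued fractions from small remainders\<close>

text \<open>
  The polynomials \<open>N\<close> and \<open>D\<close> are the continuants of the segment. Peeling off the first partial
  quotient expresses them through the continuants of the shorter segment, and the last conjunct,
  which says that they are the transition coefficients of the recurrence, is the form of the usual
  recurrence for convergents that survives this induction. The conditions on constant coefficients
  guarantee that no denominator vanishes.
\<close>

lemma cf_segment_continuants: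
  fixes a b :: "nat \<Rightarrow> 'a::field poly"
  assumes "\<And>i. i \<ge> 1 \<Longrightarrow> coeff (a i) 0 = 0" "\<And>i. i \<ge> 1 \<Longrightarrow> coeff (b i) 0 = 1"
    and "j \<ge> 1"
  shows "\<exists>N D. cf_segment a b j m = Fract N D \<and> coeff N 0 = 0 \<and> coeff D 0 = 1 \<and>
    (\<forall>y. (\<forall>i. y (i + 2) = fps_of_poly (b (i + 1)) * y (i + 1) + fps_of_poly (a (i + 1)) * y i) \<longrightarrow>
       y (j + m) = fps_of_poly D * y j + fps_of_poly N * y (j - 1))"
  using \<open>j \<ge> 1\<close>
proof (induction m arbitrary: j)
  case 0
  show ?case
    by (rule exI [of _ 0], rule exI [of _ 1]) (simp add: fract_collapse)
next
  case (Suc m)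
  obtain N D where ND: "cf_segment a b (Suc j) m = Fract N D" "coeff N 0 = 0" "coeff D 0 = 1"
    and trans: "\<And>y. (\<And>i. y (i + 2) =
        fps_of_poly (b (i + 1)) * y (i + 1) + fps_of_poly (a (i + 1)) * y i) \<Longrightarrow>
       y (Suc j + m) = fps_of_poly D * y (Suc j) + fps_of_poly N * y j"
    using Suc.IH [of "Suc j"] by auto
  define D' where "D' = b j * D + N"
  have D': "coeff D' 0 = 1"
    using ND Suc.prems assms(2) [of j] by (simp add: D'_def coeff_mult)
  have nz: "D \<noteq> 0" "D' \<noteq> 0"
    using ND D' by auto
  have "to_fract (b j) + to_fract N / to_fract D = to_fract D' / to_fract D"
    using nz by (simp add: D'_def field_simps)
  then have "cf_segment a b j (Suc m) = Fract (a j * D) D'"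
    using nz by (simp add: ND Fract_conv_to_fract)
  moreover have "coeff (a j * D) 0 = 0"
    using Suc.prems assms(1) [of j] by (simp add: coeff_mult)
  moreover have "y (j + Suc m) = fps_of_poly D' * y j + fps_of_poly (a j * D) * y (j - 1)"
    if y: "\<And>i. y (i + 2) = fps_of_poly (b (i + 1)) * y (i + 1) + fps_of_poly (a (i + 1)) * y i"
    for y
    using trans [OF y] y [of "j - 1"] Suc.prems
    by (simp add: D'_def fps_of_poly_add fps_of_poly_mult algebra_simps)
  ultimately show ?case
    using D' by blast
qed

text \<open>
  Here \<open>r n\<close> is the remainder \<open>Q\<^sub>n F - P\<^sub>n\<close>. Extending it by \<open>r\<^sub>-\<^sub>1 = -1\<close> turns the formula for
  \<open>r 1\<close> into an instance of the recurrence.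
\<close>

lemma cf_converges_toI:
  fixes a b :: "nat \<Rightarrow> 'a::field poly" and F :: "'a fps"
  assumes a0: "\<And>i. i \<ge> 1 \<Longrightarrow> coeff (a i) 0 = 0" and b0: "\<And>i. i \<ge> 1 \<Longrightarrow> coeff (b i) 0 = 1"
    and r0: "r 0 = F"
    and r1: "r 1 = fps_of_poly (b 1) * F - fps_of_poly (a 1)"
    and r_rec: "\<And>n. r (n + 2) =
          fps_of_poly (b (n + 2)) * r (n + 1) + fps_of_poly (a (n + 2)) * r n"
    and small: "\<And>n. fps_X ^ (n + 1) dvd r n"
  shows "cf_converges_to a b (fps_to_fls F)"
  unfolding cf_converges_to_def
proof (intro conjI allI)
  show "cf_defined a b"
    unfolding cf_defined_def
  proof (intro allI impI)
    fix j m :: nat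
    assume j: "j \<ge> 1"
    obtain N D where ND: "cf_segment a b (Suc j) m = Fract N D" "coeff N 0 = 0" "coeff D 0 = 1"
      using cf_segment_continuants [of a b "Suc j" m, OF a0 b0] by auto
    have "coeff (b j * D + N) 0 = 1"
      using ND b0 [OF j] by (simp add: coeff_mult)
    then have nz: "D \<noteq> 0" "b j * D + N \<noteq> 0"
      using ND by (metis coeff_0 zero_neq_one)+
    have "to_fract (b j) + cf_segment a b (Suc j) m = to_fract (b j * D + N) / to_fract D"
      using nz by (simp add: ND Fract_conv_to_fract field_simps)
    then show "to_fract (b j) + cf_segment a b (Suc j) m \<noteq> 0"
      using nz by (simp del: to_fract_add to_fract_mult)
  qed
next
  fix n :: int
  \<comment> \<open>The remainders with the index shifted by one, so that \<open>y 0\<close> is \<open>r\<^sub>-\<^sub>1\<close>.\<close>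
  define y where "y k = (case k of 0 \<Rightarrow> -1 | Suc k' \<Rightarrow> r k')" for k
  have y_rec: "y (i + 2) = fps_of_poly (b (i + 1)) * y (i + 1) + fps_of_poly (a (i + 1)) * y i" for i
    using r0 r1 r_rec [of "i - 1"] by (cases i) (simp_all add: y_def)
  have "fls_nth (laurent_of_fract (cf_convergent a b k)) n = fls_nth (fps_to_fls F) n"
    if k: "k \<ge> nat n" for k
  proof -
    obtain N D where ND: "cf_segment a b 1 k = Fract N D" "coeff D 0 = 1"
      and "y (1 + k) = fps_of_poly D * y 1 + fps_of_poly N * y 0"
      using cf_segment_continuants [of a b 1 k, OF a0 b0] y_rec by auto
    then have rk: "r k = fps_of_poly D * F - fps_of_poly N"
      using r0 by (simp add: y_def)
    have D0: "fps_of_poly D $ 0 \<noteq> 0"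
      using ND by simp
    define G where "G = fps_of_poly N * inverse (fps_of_poly D)"
    have "F - G = r k * inverse (fps_of_poly D)"
      using inverse_mult_eq_1 [OF D0] by (simp add: rk G_def algebra_simps)
    then have "fps_X ^ (k + 1) dvd F - G"
      using small [of k] by simp
    then obtain H where "F - G = fps_X ^ (k + 1) * H" ..
    then have "(F - G) $ nat n = 0"
      using k by (simp add: fps_X_power_mult_nth del: power_Suc)
    moreover have "laurent_of_fract (cf_convergent a b k) = fps_to_fls G"
    proof -
      have "D \<noteq> 0"
        using ND by auto
      moreover have "fps_to_fls G * fps_to_fls (fps_of_poly D) = fps_to_fls (fps_of_poly N)"
        using inverse_mult_eq_1 [OF D0]
        by (simp add: G_def mult.assoc flip: fls_times_fps_to_fls)
      ultimately show ?thesis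
        using fps_of_poly_eq_iff [of D 0] unfolding cf_convergent_def ND
        by (simp add: laurent_of_fract_Fract divide_eq_eq)
    qed
    ultimately show ?thesis
      by simp
  qed
  then show "\<forall>\<^sub>F k in sequentially.
      fls_nth (laurent_of_fract (cf_convergent a b k)) n = fls_nth (fps_to_fls F) n"
    unfolding eventually_sequentially by blast
qed


section \<open>The partial denominators\<close>

text \<open>The products \<open>\<sigma>\<^sub>n\<close>; the value \<open>\<sigma>\<^sub>0 = 0\<close> makes \<open>d_seq_eq\<close> hold for \<open>d\<^sub>1\<close> as well.\<close>

definition sign_prod :: "nat \<Rightarrow> complex" where
  "sign_prod n = of_int (s_seq (int n) * s_seq (int n - 1))"

lemma sign_prod_0: "sign_prod 0 = 0"
  by (simp add: sign_prod_def s_seq_minus_1)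

lemma sign_prod_cases: "n \<ge> 1 \<Longrightarrow> sign_prod n = 1 \<or> sign_prod n = - 1"
  using s_seq_values [of "int n"] s_seq_values [of "int n - 1"]
  by (auto simp: sign_prod_def)

lemma sign_prod_odd: "sign_prod (2 * n + 1) = (- 1) ^ n"
  using s_seq_even [of "int n"] s_seq_odd [of "int n"] s_seq_values [of "int n"]
  by (auto simp: sign_prod_def add.commute)

lemma sign_prod_even:
  "sign_prod (2 * n) = (- 1) ^ n * sign_prod n"
proof (cases n)
  case (Suc k)
  then show ?thesis
    using s_seq_even [of "int n"] s_seq_odd [of "int k"]
    by (simp add: sign_prod_def nat_add_distrib algebra_simps)
qed (simp add: sign_prod_0)

lemma d_seq_eq: "d_seq (Suc n) = sign_prod (Suc n) - sign_prod n"
  using s_seq_values [of "int n"]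
  by (auto simp: d_seq_def sign_prod_def algebra_simps)


section \<open>Self-similarity of the recurrence\<close>

text \<open>
  Four consecutive steps of the recurrence, starting from \<open>p = y\<^sub>2\<^sub>m\<^sub>-\<^sub>2\<close> and \<open>q = y\<^sub>2\<^sub>m\<^sub>-\<^sub>1\<close>, with
  \<open>e = (-1)\<^sup>m\<close>, \<open>u = \<sigma>\<^sub>m\<close> and \<open>v = \<sigma>\<^sub>m\<^sub>+\<^sub>1\<close>. The coefficients of \<open>x\<close> are the values of
  \<open>d\<^sub>2\<^sub>m\<close>, \<dots>, \<open>d\<^sub>2\<^sub>m\<^sub>+\<^sub>3\<close>; the identity holds only because \<open>e\<close>, \<open>u\<close> and \<open>v\<close> are signs.
\<close>

lemma contraction_identity:
  fixes x p q e u v :: "'a::comm_ring_1"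
  assumes "e = 1 \<or> e = - 1" "u = 1 \<or> u = - 1" "v = 1 \<or> v = - 1"
    and y2: "y2 = (1 - (e * u + e) * x) * q + x ^ 2 * p"
    and y3: "y3 = (1 - (e - e * u) * x) * y2 + x ^ 2 * q"
    and y4: "y4 = (1 - (- e * v - e) * x) * y3 + x ^ 2 * y2"
    and y5: "y5 = (1 - (- e + e * v) * x) * y4 + x ^ 2 * y3"
  shows "y5 - e * x * y4 = (1 - (v - u) * x ^ 2) * (y3 + e * x * y2) + x ^ 4 * (q - e * x * p)"
  unfolding y5 y4 y3 y2
  using assms(1-3) by (elim disjE; simp add: algebra_simps eval_nat_numeral)

definition cf_recurrence :: "(nat \<Rightarrow> complex fps) \<Rightarrow> bool" where
  "cf_recurrence y \<longleftrightarrow>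
     (\<forall>n. y (n + 2) = (1 - fps_const (d_seq (n + 2)) * fps_X) * y (n + 1) + fps_X ^ 2 * y n)"

definition contract :: "(nat \<Rightarrow> complex fps) \<Rightarrow> nat \<Rightarrow> complex fps" where
  "contract y n = y (2 * n + 1) + (- 1) ^ n * fps_X * y (2 * n)"

lemma recurrence_doubling:
  assumes "cf_recurrence y"
  shows "contract y (n + 2) =
    (1 - fps_const (d_seq (n + 2)) * fps_X ^ 2) * contract y (n + 1) + fps_X ^ 4 * contract y n"
proof -
  \<comment> \<open>The index \<open>m\<close> in the comment on \<open>contraction_identity\<close> is \<open>n + 1\<close>.\<close>
  define e where "e = ((- 1) ^ (n + 1) :: complex)"
  define u where "u = sign_prod (n + 1)"
  define v where "v = sign_prod (n + 2)"
  have s: "sign_prod (2 * n + 1) = - e" "sign_prod (2 * n + 2) = e * u"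
      "sign_prod (2 * n + 3) = e" "sign_prod (2 * n + 4) = - e * v" "sign_prod (2 * n + 5) = - e"
    using sign_prod_odd [of n] sign_prod_odd [of "n + 1"] sign_prod_odd [of "n + 2"]
      sign_prod_even [of "n + 1"] sign_prod_even [of "n + 2"]
    by (simp_all add: e_def u_def v_def numeral_eq_Suc)
  have d: "d_seq (2 * n + 2) = e * u + e" "d_seq (2 * n + 3) = e - e * u"
      "d_seq (2 * n + 4) = - e * v - e" "d_seq (2 * n + 5) = - e + e * v" "d_seq (n + 2) = v - u"
    using d_seq_eq [of "2 * n + 1"] d_seq_eq [of "2 * n + 2"] d_seq_eq [of "2 * n + 3"]
      d_seq_eq [of "2 * n + 4"] d_seq_eq [of "n + 1"] s
    by (simp_all add: u_def v_def numeral_eq_Suc)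
  let ?e = "fps_const e" and ?u = "fps_const u" and ?v = "fps_const v"
  have signs: "?e = 1 \<or> ?e = - 1" "?u = 1 \<or> ?u = - 1" "?v = 1 \<or> ?v = - 1"
    using sign_prod_cases [of "n + 1"] sign_prod_cases [of "n + 2"]
    by (cases "even n"; auto simp: e_def u_def v_def simp flip: fps_const_neg)+
  have y: "y (m + 2) = (1 - fps_const (d_seq (m + 2)) * fps_X) * y (m + 1) + fps_X ^ 2 * y m" for m
    using assms by (simp add: cf_recurrence_def)
  have "y (2 * n + 5) - ?e * fps_X * y (2 * n + 4) =
      (1 - (?v - ?u) * fps_X ^ 2) * (y (2 * n + 3) + ?e * fps_X * y (2 * n + 2)) +
      fps_X ^ 4 * (y (2 * n + 1) - ?e * fps_X * y (2 * n))"
    by (rule contraction_identity [OF signs])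
      (use y [of "2 * n"] y [of "2 * n + 1"] y [of "2 * n + 2"] y [of "2 * n + 3"] d in
        \<open>simp_all add: numeral_eq_Suc flip: fps_const_add fps_const_sub fps_const_mult fps_const_neg\<close>)
  moreover have "?e = (- 1) ^ (n + 1)"
    by (cases "even n") (auto simp: e_def simp flip: fps_const_neg)
  ultimately show ?thesis
    using d by (simp add: contract_def numeral_eq_Suc flip: fps_const_sub)
qed

text \<open>
  Eliminating \<open>y (2n + 1)\<close> from the contraction by one step of the recurrence leaves only earlier
  entries. Since the factor in parentheses is invertible, the contraction and \<open>y (2n - 1)\<close> together
  control \<open>y (2n)\<close>, which the definition of the contraction alone does not.
\<close>

lemma contract_eq_previous:
  assumes "cf_recurrence y" "n \<ge> 1"
  shows "contract y n =
    (1 + fps_const ((- 1) ^ n * sign_prod n) * fps_X) * y (2 * n) + fps_X ^ 2 * y (2 * n - 1)"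
proof -
  obtain k where k: "2 * n = Suc k"
    using assms(2) by (cases "2 * n") auto
  define e where "e = fps_const ((- 1) ^ n :: complex)"
  define w where "w = fps_const (sign_prod n)"
  have "d_seq (k + 2) = (- 1) ^ n - (- 1) ^ n * sign_prod n"
    using d_seq_eq [of "Suc k"] sign_prod_odd [of n] sign_prod_even [of n] k by simp
  then have "fps_const (d_seq (k + 2)) = e - e * w"
    by (simp add: e_def w_def)
  moreover have "y (k + 2) = (1 - fps_const (d_seq (k + 2)) * fps_X) * y (k + 1) + fps_X ^ 2 * y k"
    using assms(1) by (simp add: cf_recurrence_def)
  ultimately have "y (2 * n + 1) = (1 - (e - e * w) * fps_X) * y (2 * n) + fps_X ^ 2 * y (2 * n - 1)"
    using k by simp
  moreover have "(- 1) ^ n = e"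
    by (cases "even n") (auto simp: e_def simp flip: fps_const_neg)
  moreover have "fps_const ((- 1) ^ n * sign_prod n) = e * w"
    by (simp add: e_def w_def)
  ultimately show ?thesis
    by (simp only: contract_def) (simp add: algebra_simps)
qed


section \<open>The lacunary series and its remainders\<close>

definition lacunary :: "complex fps" where
  "lacunary = Abs_fps (\<lambda>n. if \<exists>k. n = 2 ^ k then 1 else 0)"

lemma lacunary_sums: "(\<lambda>k. fps_X ^ (2 ^ k)) sums lacunary"
  unfolding sums_def
proof (rule tendsto_fpsI)
  fix n
  have "(\<Sum>k<K. fps_X ^ (2 ^ k) :: complex fps) $ n = lacunary $ n" if "K \<ge> n" for K
  proof (cases "\<exists>k. n = 2 ^ k")
    case True
    then obtain k where k: "n = 2 ^ k" ..
    have "k < K"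
      using less_exp [of k] k that by linarith
    then show ?thesis
      using k by (simp add: fps_sum_nth lacunary_def)
  qed (auto simp: fps_sum_nth lacunary_def intro!: sum.neutral)
  then show "\<forall>\<^sub>F K in sequentially. (\<Sum>k<K. fps_X ^ (2 ^ k) :: complex fps) $ n = lacunary $ n"
    unfolding eventually_sequentially by blast
qed

lemma power_of_2_iff: "(\<exists>k. n = 2 ^ k) \<longleftrightarrow> n = 1 \<or> even n \<and> (\<exists>k. n div 2 = 2 ^ k)" for n :: nat
proof
  assume "\<exists>k. n = 2 ^ k"
  then obtain k where "n = 2 ^ k" ..
  then show "n = 1 \<or> even n \<and> (\<exists>k. n div 2 = 2 ^ k)"
    by (cases k) auto
next
  assume "n = 1 \<or> even n \<and> (\<exists>k. n div 2 = 2 ^ k)"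
  then show "\<exists>k. n = 2 ^ k"
  proof
    assume "even n \<and> (\<exists>k. n div 2 = 2 ^ k)"
    then obtain k where "n = 2 ^ Suc k"
      by (auto elim!: evenE)
    then show ?thesis ..
  qed (auto intro: exI [of _ 0])
qed

lemma lacunary_functional_equation: "lacunary = fps_X + (lacunary oo fps_X ^ 2)"
proof (rule fps_ext)
  fix n
  show "lacunary $ n = (fps_X + (lacunary oo fps_X ^ 2)) $ n"
    using power_of_2_iff [of n]
    by (auto simp: lacunary_def fps_nth_compose_X_power)
qed

fun remainder :: "nat \<Rightarrow> complex fps" where
  "remainder 0 = lacunary"
| "remainder (Suc 0) = (1 - fps_X) * lacunary - fps_X"
| "remainder (Suc (Suc n)) =
     (1 - fps_const (d_seq (n + 2)) * fps_X) * remainder (Suc n) + fps_X ^ 2 * remainder n"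

lemma cf_recurrence_remainder: "cf_recurrence remainder"
  by (simp add: cf_recurrence_def numeral_eq_Suc)

lemma d_seq_values: "d_seq 1 = 1" "d_seq 2 = - 2" "d_seq 3 = 0" "d_seq 4 = 0" "d_seq 5 = 2"
proof -
  have "sign_prod 1 = 1" "sign_prod 3 = - 1" "sign_prod 5 = 1"
    using sign_prod_odd [of 0] sign_prod_odd [of 1] sign_prod_odd [of 2] by simp_all
  moreover from this have "sign_prod 2 = - 1" "sign_prod 4 = - 1"
    using sign_prod_even [of 1] sign_prod_even [of 2] by simp_all
  ultimately show "d_seq 1 = 1" "d_seq 2 = - 2" "d_seq 3 = 0" "d_seq 4 = 0" "d_seq 5 = 2"
    using d_seq_eq [of 0] d_seq_eq [of 1] d_seq_eq [of 2] d_seq_eq [of 3] d_seq_eq [of 4]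
    by (simp_all add: sign_prod_0 eval_nat_numeral)
qed

text \<open>
  Both sides satisfy the recurrence in \<open>X\<^sup>2\<close>, so it suffices to compare the two initial values,
  and these agree by the functional equation of the lacunary series.
\<close>

lemma remainder_doubling: "contract remainder n = remainder n oo fps_X ^ 2"
proof (induction n rule: induct_nat_012)
  case 0
  show ?case
    using lacunary_functional_equation by (simp add: contract_def algebra_simps)
next
  case 1
  define F2 where "F2 = (lacunary oo fps_X ^ 2)"
  have F: "lacunary = fps_X + F2"
    unfolding F2_def by (rule lacunary_functional_equation)
  have c: "fps_const (- 2) = (- 2 :: complex fps)"
    by (simp flip: numeral_fps_const fps_const_neg)
  have r2: "remainder 2 = (1 + 2 * fps_X) * remainder 1 + fps_X ^ 2 * lacunary"
    using d_seq_values(2) c by (simp add: numeral_2_eq_2)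
  have r3: "remainder 3 = remainder 2 + fps_X ^ 2 * remainder 1"
    using d_seq_values(3) by (simp add: numeral_eq_Suc)
  have "contract remainder 1 = remainder 3 - fps_X * remainder 2"
    by (simp add: contract_def numeral_eq_Suc)
  also have "\<dots> = (1 - fps_X ^ 2) * F2 - fps_X ^ 2"
    unfolding r3 r2 by (simp add: F algebra_simps eval_nat_numeral)
  also have "\<dots> = remainder 1 oo fps_X ^ 2"
    by (simp add: F2_def fps_compose_sub_distrib fps_compose_mult_distrib)
  finally show ?case
    by simp
next
  case (ge2 n)
  then show ?case
    using recurrence_doubling [OF cf_recurrence_remainder, of n]
    by (simp add: fps_compose_add_distrib fps_compose_sub_distrib fps_compose_mult_distrib
        flip: fps_compose_power power_mult)
qed

text \<open>
  For even indices \<open>2n > 0\<close> the bound comes from \<open>contract_eq_previous\<close>, for odd ones from the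
  definition of the contraction; in both cases \<open>remainder_doubling\<close> gives divisibility of the
  contraction by \<open>X\<^sup>2\<^sup>n\<^sup>+\<^sup>2\<close>.
\<close>

lemma X_power_dvd_remainder: "fps_X ^ (n + 1) dvd remainder n"
proof (induction n rule: less_induct)
  case (less n)
  have contract: "fps_X ^ (2 * m + 2) dvd contract remainder m" if "m < n" for m
  proof -
    obtain h where "remainder m = fps_X ^ (m + 1) * h"
      using less.IH [OF \<open>m < n\<close>] by (elim dvdE)
    moreover have "(fps_X ^ (m + 1) oo fps_X ^ 2) = (fps_X ^ (2 * m + 2) :: complex fps)"
      by (simp del: power_Suc flip: fps_compose_power power_mult)
    ultimately have "contract remainder m = fps_X ^ (2 * m + 2) * (h oo fps_X ^ 2)"
      by (simp add: remainder_doubling fps_compose_mult_distrib del: power_Suc)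
    then show ?thesis ..
  qed
  consider "n = 0" | m where "n = 2 * m" "m \<ge> 1" | m where "n = 2 * m + 1"
    by (metis One_nat_def Suc_leI mult_0_right neq0_conv oddE evenE)
  then show ?case
  proof cases
    case 1
    have "lacunary = fps_X * fps_shift 1 lacunary"
      by (rule fps_ext) (simp add: lacunary_def)
    then have "fps_X dvd lacunary" ..
    then show ?thesis
      by (simp add: 1)
  next
    case (2 m)
    define c :: "complex fps" where "c = 1 + fps_const ((- 1) ^ m * sign_prod m) * fps_X"
    have "fps_X ^ (n + 1) dvd contract remainder m"
      using contract [of m] 2 by (auto intro: dvd_trans [OF le_imp_power_dvd])
    moreover have "fps_X ^ (n + 1) dvd fps_X ^ 2 * remainder (n - 1)"
    proof -
      have "fps_X ^ 2 * fps_X ^ (n - 1 + 1) dvd fps_X ^ 2 * remainder (n - 1)"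
        using less.IH [of "n - 1"] 2 by (intro mult_dvd_mono) auto
      then show ?thesis
        using 2 by (auto simp flip: power_add intro: dvd_trans [OF le_imp_power_dvd])
    qed
    moreover have "contract remainder m = c * remainder n + fps_X ^ 2 * remainder (n - 1)"
      using contract_eq_previous [OF cf_recurrence_remainder, of m] 2 by (simp add: c_def)
    ultimately have "fps_X ^ (n + 1) dvd c * remainder n"
      by (simp add: dvd_add_left_iff)
    moreover have "c dvd 1"
      by (simp add: c_def)
    ultimately show ?thesis
      by (simp add: dvd_mult_unit_iff')
  next
    case (3 m)
    have "fps_X ^ (n + 1) dvd contract remainder m"
      using contract [of m] 3 by simp
    moreover have "fps_X ^ (n + 1) dvd (- 1) ^ m * fps_X * remainder (2 * m)"
    proof -
      have "fps_X * fps_X ^ (2 * m + 1) dvd fps_X * remainder (2 * m)"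
        using less.IH [of "2 * m"] 3 by (intro mult_dvd_mono) auto
      then show ?thesis
        using 3 by (simp add: mult.assoc)
    qed
    ultimately show ?thesis
      using 3 by (simp add: contract_def dvd_add_left_iff)
  qed
qed

theorem theorem1p4:
  shows "summable (\<lambda>k::nat. fps_X ^ (2 ^ k) :: complex fps)
    \<and> cf_converges_to
          (\<lambda>n. if n = 1 then X else X ^ 2)
          (\<lambda>n. 1 - smult (d_seq n) X)
          (fps_to_fls (\<Sum>k::nat. fps_X ^ (2 ^ k)))
    \<and> map (\<lambda>n. 1 - smult (d_seq n) X) [1, 2, 3, 4, 5]
        = [1 - X, 1 + 2 * X, 1, 1, 1 - 2 * X]"
proof (intro conjI)
  have poly_eq: "fps_of_poly (1 - smult c X) = 1 - fps_const c * fps_X"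
      "fps_of_poly (X ^ 2) = (fps_X ^ 2 :: complex fps)" for c :: complex
    by (simp_all only: fps_of_poly_diff fps_of_poly_smult fps_of_poly_power
        fps_of_poly_fps_X fps_of_poly_1)
  show "summable (\<lambda>k::nat. fps_X ^ (2 ^ k) :: complex fps)"
    using lacunary_sums by (rule sums_summable)
  have "cf_converges_to (\<lambda>n. if n = 1 then X else X ^ 2) (\<lambda>n. 1 - smult (d_seq n) X)
      (fps_to_fls lacunary)"
  proof (rule cf_converges_toI [where r = remainder])
    show "remainder 1 = fps_of_poly (1 - smult (d_seq 1) X) * lacunary -
        fps_of_poly (if (1::nat) = 1 then X else X ^ 2)"
      unfolding poly_eq d_seq_values by simp
    show "remainder (n + 2) = fps_of_poly (1 - smult (d_seq (n + 2)) X) * remainder (n + 1) +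
        fps_of_poly (if n + 2 = 1 then X else X ^ 2) * remainder n" for n
      by (simp add: poly_eq numeral_eq_Suc del: smult_pCons)
    show "fps_X ^ (n + 1) dvd remainder n" for n
      by (rule X_power_dvd_remainder)
  qed (auto simp: coeff_mult power2_eq_square)
  then show "cf_converges_to (\<lambda>n. if n = 1 then X else X ^ 2) (\<lambda>n. 1 - smult (d_seq n) X)
      (fps_to_fls (\<Sum>k::nat. fps_X ^ (2 ^ k)))"
    using sums_unique [OF lacunary_sums] by simp
  show "map (\<lambda>n. 1 - smult (d_seq n) X) [1, 2, 3, 4, 5] = [1 - X, 1 + 2 * X, 1, 1, 1 - 2 * X]"
    using d_seq_values by (simp add: numeral_poly)
qed

end
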